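(* Let $W_{(\alpha,\beta)}\equiv(T_1,T_2)$ be a (commuting) $2$-variable weighted shift on $\ell^2(\mathbb{Z}_+^2)$. The following statements are equivalent: (i) $W_{(\alpha,\beta)}$ is spherically quasinormal; (ii) there is a constant $C>0$ such that $\alpha_{(k_1,k_2)}^2+\beta_{(k_1,k_2)}^2=C$ for all $(k_1,k_2)\in\mathbb{Z}_+^2$; (iii) there is a constant $C>0$ such that $T_1^*T_1+T_2^*T_2=C\cdot I$.
   Context: $\mathbb{Z}_+=\{0,1,2,\dots\}$, $\varepsilon_1=(1,0)$, $\varepsilon_2=(0,1)$, and $\{e_{\mathbf k}\}$ is the canonical orthonormal basis of $\ell^2(\mathbb{Z}_+^2)$. Given bounded families of positive numbers $(\alpha_{\mathbf k})$, $(\beta_{\mathbf k})$, $\mathbf k\in\mathbb{Z}_+^2$, the $2$-variable weighted shift $W_{(\alpha,\beta)}\equiv(T_1,T_2)$ is given by $T_1e_{\mathbf k}=\alpha_{\mathbf k}e_{\mathbf k+\varepsilon_1}$, $T_2e_{\mathbf k}=\beta_{\mathbf k}e_{\mathbf k+\varepsilon_2}$; it is assumed commuting, i.e. $\beta_{\mathbf k+\varepsilon_1}\alpha_{\mathbf k}=\alpha_{\mathbf k+\varepsilon_2}\beta_{\mathbf k}$ for all $\mathbf k$. A commuting pair $(T_1,T_2)$ is spherically quasinormal if each of $T_1$ and $T_2$ commutes with $P^2:=T_1^*T_1+T_2^*T_2$. *)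

theory Defs
  imports "HOL-Analysis.Analysis"
begin

section \<open>The complex Hilbert space of square-summable families\<close>

typedef 'i ell2 = "{x :: 'i \<Rightarrow> complex. (\<lambda>k. (cmod (x k))\<^sup>2) summable_on UNIV}"
  morphisms ell2_nth Abs_ell2
  by (rule exI[of _ "\<lambda>_. 0"]) simp

setup_lifting type_definition_ell2

lemma ell2_sq_summable: "(\<lambda>k. (cmod (ell2_nth x k))\<^sup>2) summable_on UNIV"
  using ell2_nth by blast

lemma ell2_eqI: "(\<And>k. ell2_nth x k = ell2_nth y k) \<Longrightarrow> x = y"
  by (metis ext ell2_nth_inject)

lemma cmod_add_sq_le: "(cmod (a + b))\<^sup>2 \<le> 2 * (cmod a)\<^sup>2 + 2 * (cmod b)\<^sup>2"
proof -
  have "(cmod (a + b))\<^sup>2 \<le> (cmod a + cmod b)\<^sup>2"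
    by (intro power_mono norm_triangle_ineq) simp
  also have "\<dots> \<le> 2 * (cmod a)\<^sup>2 + 2 * (cmod b)\<^sup>2"
    using sum_squares_bound[of "cmod a" "cmod b"] by (simp add: power2_sum)
  finally show ?thesis .
qed

lemma sq_summable_add:
  assumes "(\<lambda>k. (cmod (f k))\<^sup>2) summable_on A" "(\<lambda>k. (cmod (g k))\<^sup>2) summable_on A"
  shows "(\<lambda>k. (cmod (f k + g k))\<^sup>2) summable_on A"
proof (rule summable_on_comparison_test)
  show "(\<lambda>k. 2 * (cmod (f k))\<^sup>2 + 2 * (cmod (g k))\<^sup>2) summable_on A"
    by (intro summable_on_add summable_on_cmult_right assms)
qed (use cmod_add_sq_le in auto)

lemma sq_summable_scale:
  assumes "(\<lambda>k. (cmod (f k))\<^sup>2) summable_on A"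
  shows "(\<lambda>k. (cmod (c * f k))\<^sup>2) summable_on A"
  by (simp add: norm_mult power_mult_distrib summable_on_cmult_right assms)

lemma sq_summable_mult_cnj:
  assumes "(\<lambda>k. (cmod (f k))\<^sup>2) summable_on A" "(\<lambda>k. (cmod (g k))\<^sup>2) summable_on A"
  shows "(\<lambda>k. f k * cnj (g k)) summable_on A"
proof (rule abs_summable_summable, rule summable_on_comparison_test)
  show "(\<lambda>k. (cmod (f k))\<^sup>2 + (cmod (g k))\<^sup>2) summable_on A"
    by (intro summable_on_add assms)
  show "norm (f k * cnj (g k)) \<le> (cmod (f k))\<^sup>2 + (cmod (g k))\<^sup>2" for k
  proof -
    have "0 \<le> cmod (f k) * cmod (g k)" by simp
    moreover have "2 * (cmod (f k) * cmod (g k)) \<le> (cmod (f k))\<^sup>2 + (cmod (g k))\<^sup>2"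
      using sum_squares_bound[of "cmod (f k)" "cmod (g k)"] by (simp add: mult.assoc)
    ultimately show ?thesis
      unfolding norm_mult complex_mod_cnj by linarith
  qed
qed auto

instantiation ell2 :: (type) real_vector
begin

lift_definition zero_ell2 :: "'a ell2" is "\<lambda>_. 0" by simp
lift_definition plus_ell2 :: "'a ell2 \<Rightarrow> 'a ell2 \<Rightarrow> 'a ell2" is "\<lambda>x y k. x k + y k"
  by (rule sq_summable_add)
lift_definition uminus_ell2 :: "'a ell2 \<Rightarrow> 'a ell2" is "\<lambda>x k. - x k" by simp
lift_definition minus_ell2 :: "'a ell2 \<Rightarrow> 'a ell2 \<Rightarrow> 'a ell2" is "\<lambda>x y k. x k - y k"
  using sq_summable_add[of _ UNIV "\<lambda>k. - _ k"] by simp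
lift_definition scaleR_ell2 :: "real \<Rightarrow> 'a ell2 \<Rightarrow> 'a ell2" is "\<lambda>r x k. complex_of_real r * x k"
  by (rule sq_summable_scale)

instance
  by standard (transfer; auto simp: algebra_simps)+

end

lift_definition scaleC :: "complex \<Rightarrow> 'i ell2 \<Rightarrow> 'i ell2" (infixr "*\<^sub>C" 75) is "\<lambda>c x k. c * x k"
  by (rule sq_summable_scale)

text \<open>Linear in the first argument, conjugate-linear in the second.\<close>

definition cinner :: "'i ell2 \<Rightarrow> 'i ell2 \<Rightarrow> complex" where
  "cinner x y = (\<Sum>\<^sub>\<infinity>k. ell2_nth x k * cnj (ell2_nth y k))"

lemma cinner_summable: "(\<lambda>k. ell2_nth x k * cnj (ell2_nth y k)) summable_on UNIV"
  by (intro sq_summable_mult_cnj ell2_sq_summable)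

lemma cinner_add_left: "cinner (x + y) z = cinner x z + cinner y z"
  unfolding cinner_def
  by (simp add: plus_ell2.rep_eq distrib_right infsum_add cinner_summable)

lemma cinner_scaleC_left: "cinner (c *\<^sub>C x) y = c * cinner x y"
  unfolding cinner_def
  by (simp add: scaleC.rep_eq mult.assoc infsum_cmult_right')

lemma cinner_commute: "cinner x y = cnj (cinner y x)"
  unfolding cinner_def by (simp flip: infsum_cnj add: mult.commute)

lemma scaleR_scaleC: "r *\<^sub>R x = complex_of_real r *\<^sub>C x"
  by transfer simp

lemma cinner_self: "cinner x x = complex_of_real (\<Sum>\<^sub>\<infinity>k. (cmod (ell2_nth x k))\<^sup>2)"
proof -
  have "((\<lambda>k. complex_of_real ((cmod (ell2_nth x k))\<^sup>2)) has_sum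
          complex_of_real (\<Sum>\<^sub>\<infinity>k. (cmod (ell2_nth x k))\<^sup>2)) UNIV"
    by (intro has_sum_of_real has_sum_infsum ell2_sq_summable)
  then show ?thesis
    unfolding cinner_def by (simp add: complex_norm_square infsumI del: of_real_power)
qed

instantiation ell2 :: (type) real_inner
begin

definition inner_ell2 :: "'a ell2 \<Rightarrow> 'a ell2 \<Rightarrow> real" where
  "inner_ell2 x y = Re (cinner x y)"
definition norm_ell2 :: "'a ell2 \<Rightarrow> real" where
  "norm_ell2 x = sqrt (\<Sum>\<^sub>\<infinity>k. (cmod (ell2_nth x k))\<^sup>2)"
definition sgn_ell2 :: "'a ell2 \<Rightarrow> 'a ell2" where
  "sgn_ell2 x = x /\<^sub>R norm x"
definition dist_ell2 :: "'a ell2 \<Rightarrow> 'a ell2 \<Rightarrow> real" where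
  "dist_ell2 x y = norm (x - y)"
definition uniformity_ell2 :: "('a ell2 \<times> 'a ell2) filter" where
  "uniformity_ell2 = (INF e\<in>{0<..}. principal {(x, y). dist x y < e})"
definition open_ell2 :: "'a ell2 set \<Rightarrow> bool" where
  "open_ell2 U \<longleftrightarrow> (\<forall>x\<in>U. \<forall>\<^sub>F (x', y) in uniformity. x' = x \<longrightarrow> y \<in> U)"

instance
proof
  fix x y z :: "'a ell2" and r :: real
  show "inner x y = inner y x"
    unfolding inner_ell2_def by (metis cinner_commute cnj.simps(1))
  show "inner (x + y) z = inner x z + inner y z"
    by (simp add: inner_ell2_def cinner_add_left)
  show "inner (r *\<^sub>R x) y = r * inner x y"
    by (simp add: inner_ell2_def scaleR_scaleC cinner_scaleC_left)
  show "0 \<le> inner x x"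
    by (simp add: inner_ell2_def cinner_self infsum_nonneg)
  show "inner x x = 0 \<longleftrightarrow> x = 0"
  proof
    assume "inner x x = 0"
    then have s: "(\<Sum>\<^sub>\<infinity>k. (cmod (ell2_nth x k))\<^sup>2) = 0"
      by (simp add: inner_ell2_def cinner_self)
    have "(cmod (ell2_nth x k))\<^sup>2 = 0" for k
      by (rule nonneg_infsum_le_0D[of _ UNIV]) (use s in \<open>auto simp: ell2_sq_summable\<close>)
    then show "x = 0"
      by (intro ell2_eqI) (simp add: zero_ell2.rep_eq)
  qed (simp add: inner_ell2_def cinner_def zero_ell2.rep_eq)
  show "norm x = sqrt (inner x x)"
    by (simp add: norm_ell2_def inner_ell2_def cinner_self)
qed (simp_all add: sgn_ell2_def dist_ell2_def uniformity_ell2_def open_ell2_def)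

end

lift_definition ket :: "'i \<Rightarrow> 'i ell2" is "\<lambda>k j. if j = k then 1 else 0"
  by (rule summable_on_cong_neutral[THEN iffD1, OF _ _ _ summable_on_finite[of "{_}" "\<lambda>_. 1"]]) auto

lemma cinner_ket_right: "cinner x (ket k) = ell2_nth x k"
proof -
  have "cinner x (ket k) = (\<Sum>\<^sub>\<infinity>j\<in>{k}. ell2_nth x j * cnj (ell2_nth (ket k) j))"
    unfolding cinner_def by (rule infsum_cong_neutral) (auto simp: ket.rep_eq)
  then show ?thesis by (simp add: ket.rep_eq)
qed

lemma cinner_nondegenerate: "(\<And>x. cinner x y = cinner x z) \<Longrightarrow> y = z"
  by (metis cinner_commute cinner_ket_right ell2_eqI)

lemma norm_scaleC: "norm (c *\<^sub>C x) = cmod c * norm x"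
  by (simp add: norm_ell2_def scaleC.rep_eq norm_mult power_mult_distrib infsum_cmult_right'
      real_sqrt_mult)

lemma bounded_linear_cinner_left: "bounded_linear (\<lambda>x. cinner x y)"
proof (rule bounded_linear_intro)
  show "norm (cinner x y) \<le> norm x * (2 * norm y)" for x
  proof -
    have "Im (cinner x y) = inner ((-\<i>) *\<^sub>C x) y"
      by (simp add: inner_ell2_def cinner_scaleC_left)
    then have "\<bar>Im (cinner x y)\<bar> \<le> norm x * norm y"
      using Cauchy_Schwarz_ineq2[of "(-\<i>) *\<^sub>C x" y] by (simp add: norm_scaleC)
    moreover have "\<bar>Re (cinner x y)\<bar> \<le> norm x * norm y"
      using Cauchy_Schwarz_ineq2[of x y] by (simp add: inner_ell2_def)
    ultimately show ?thesis
      using cmod_le[of "cinner x y"] by linarith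
  qed
qed (simp_all add: cinner_add_left scaleR_scaleC cinner_scaleC_left scaleR_conv_of_real)

lemma ell2_nth_sum: "ell2_nth (\<Sum>k\<in>F. f k) j = (\<Sum>k\<in>F. ell2_nth (f k) j)"
  by (induction F rule: infinite_finite_induct) (auto simp: zero_ell2.rep_eq plus_ell2.rep_eq)

lemma ell2_nth_sum_ket:
  "finite F \<Longrightarrow> ell2_nth (\<Sum>k\<in>F. a k *\<^sub>C ket k) j = (if j \<in> F then a j else 0)"
  by (simp add: ell2_nth_sum scaleC.rep_eq ket.rep_eq if_distrib cong: if_cong)

lemma norm_sum_ket_sq:
  assumes "finite F"
  shows "(norm (\<Sum>k\<in>F. a k *\<^sub>C ket k))\<^sup>2 = (\<Sum>k\<in>F. (cmod (a k))\<^sup>2)"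
proof -
  have "(\<Sum>\<^sub>\<infinity>k. (cmod (ell2_nth (\<Sum>k\<in>F. a k *\<^sub>C ket k) k))\<^sup>2) = (\<Sum>\<^sub>\<infinity>k\<in>F. (cmod (a k))\<^sup>2)"
    by (rule infsum_cong_neutral) (auto simp: ell2_nth_sum_ket assms)
  then show ?thesis
    by (simp add: norm_ell2_def assms sum_nonneg)
qed

lemma has_sum_ket: "((\<lambda>k. ell2_nth x k *\<^sub>C ket k) has_sum x) UNIV"
proof -
  let ?s = "\<lambda>F. \<Sum>k\<in>F. ell2_nth x k *\<^sub>C ket k"
  let ?q = "\<lambda>k. (cmod (ell2_nth x k))\<^sup>2"
  have n: "(norm (?s F - x))\<^sup>2 = infsum ?q UNIV - sum ?q F" if "finite F" for F
  proof -
    have "(norm (?s F - x))\<^sup>2 = (\<Sum>\<^sub>\<infinity>k. (cmod (ell2_nth (?s F - x) k))\<^sup>2)"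
      by (simp add: norm_ell2_def infsum_nonneg)
    also have "\<dots> = infsum ?q (UNIV - F)"
      by (rule infsum_cong_neutral) (auto simp: minus_ell2.rep_eq ell2_nth_sum_ket that)
    also have "\<dots> = infsum ?q UNIV - infsum ?q F"
      by (intro infsum_Diff ell2_sq_summable summable_on_finite that) simp
    finally show ?thesis using that by simp
  qed
  have "(sum ?q \<longlongrightarrow> infsum ?q UNIV) (finite_subsets_at_top UNIV)"
    using has_sum_infsum[OF ell2_sq_summable] by (simp add: has_sum_def)
  then have "((\<lambda>F. sqrt (infsum ?q UNIV - sum ?q F)) \<longlongrightarrow> sqrt (infsum ?q UNIV - infsum ?q UNIV))
      (finite_subsets_at_top UNIV)"
    by (intro tendsto_intros)
  then have lim: "((\<lambda>F. sqrt (infsum ?q UNIV - sum ?q F)) \<longlongrightarrow> 0) (finite_subsets_at_top UNIV)"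
    by (simp only: diff_self real_sqrt_zero)
  have "sqrt (infsum ?q UNIV - sum ?q F) = norm (?s F - x)" if "finite F" for F
    unfolding n[OF that, symmetric] by (rule real_sqrt_unique) auto
  then have "\<forall>\<^sub>F F in finite_subsets_at_top UNIV.
      sqrt (infsum ?q UNIV - sum ?q F) = norm (?s F - x)"
    by (intro eventually_finite_subsets_at_top_weakI) blast
  then have "((\<lambda>F. norm (?s F - x)) \<longlongrightarrow> 0) (finite_subsets_at_top UNIV)"
    by (rule Lim_transform_eventually[OF lim])
  then show ?thesis
    unfolding has_sum_def by (rule Lim_null[THEN iffD2, OF tendsto_norm_zero_cancel])
qed

section \<open>Bounded operators and adjoints\<close>

definition bounded_clinear :: "('i ell2 \<Rightarrow> 'j ell2) \<Rightarrow> bool" where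
  "bounded_clinear T \<longleftrightarrow> bounded_linear T \<and> (\<forall>c x. T (c *\<^sub>C x) = c *\<^sub>C T x)"

definition hilbert_adjoint :: "('i ell2 \<Rightarrow> 'j ell2) \<Rightarrow> 'j ell2 \<Rightarrow> 'i ell2" where
  "hilbert_adjoint T = (THE S. \<forall>x y. cinner (T x) y = cinner x (S y))"

lemma hilbert_adjoint_eqI:
  assumes "\<And>x y. cinner (T x) y = cinner x (S y)"
  shows "hilbert_adjoint T = S"
  unfolding hilbert_adjoint_def
proof (rule the_equality)
  fix S' assume "\<forall>x y. cinner (T x) y = cinner x (S' y)"
  then show "S' = S"
    using assms by (intro ext cinner_nondegenerate) metis
qed (use assms in blast)

lemma cinner_hilbert_adjoint:
  assumes "bounded_clinear T"
  shows "cinner (T x) y = cinner x (hilbert_adjoint T y)"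
proof -
  have bl: "bounded_linear T" and sc: "\<And>c x. T (c *\<^sub>C x) = c *\<^sub>C T x"
    using assms by (auto simp: bounded_clinear_def)
  obtain K where K: "K > 0" "\<And>x. norm (T x) \<le> norm x * K"
    using bounded_linear.pos_bounded[OF bl] by blast
  define a where "a y k = cnj (cinner (T (ket k)) y)" for y k
  have summ: "(\<lambda>k. (cmod (a y k))\<^sup>2) summable_on UNIV" for y
  proof (rule nonneg_bdd_above_summable_on)
    have "sum (\<lambda>k. (cmod (a y k))\<^sup>2) F \<le> (K * norm y)\<^sup>2" if F: "finite F" for F
    proof -
      let ?v = "\<Sum>k\<in>F. a y k *\<^sub>C ket k" and ?Q = "sum (\<lambda>k. (cmod (a y k))\<^sup>2) F"
      have "cinner (T ?v) y = (\<Sum>k\<in>F. cinner (T (a y k *\<^sub>C ket k)) y)"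
        by (simp add: linear_sum[OF bounded_linear.linear[OF bl]]
            linear_sum[OF bounded_linear.linear[OF bounded_linear_cinner_left]])
      also have "\<dots> = (\<Sum>k\<in>F. a y k * cnj (a y k))"
        by (simp add: sc cinner_scaleC_left a_def)
      also have "\<dots> = complex_of_real ?Q"
        by (simp add: complex_norm_square del: of_real_power)
      finally have "?Q = inner (T ?v) y"
        by (simp add: inner_ell2_def)
      also have "\<dots> \<le> norm (T ?v) * norm y"
        by (rule norm_cauchy_schwarz)
      also have "\<dots> \<le> norm ?v * K * norm y"
        by (intro mult_right_mono K) simp
      finally have "(norm ?v)\<^sup>2 \<le> norm ?v * (K * norm y)"
        using norm_sum_ket_sq[OF F, of "a y"] by (simp add: mult.assoc)
      then have "norm ?v \<le> K * norm y"
        using K(1) by (cases "norm ?v = 0") (auto simp: power2_eq_square mult_le_cancel_left)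
      then have "(norm ?v)\<^sup>2 \<le> (K * norm y)\<^sup>2"
        by (intro power_mono) auto
      then show ?thesis
        using norm_sum_ket_sq[OF F, of "a y"] by simp
    qed
    then show "bdd_above (sum (\<lambda>k. (cmod (a y k))\<^sup>2) ` {F. F \<subseteq> UNIV \<and> finite F})"
      by (intro bdd_aboveI[of _ "(K * norm y)\<^sup>2"]) auto
  qed simp
  define S where "S y = Abs_ell2 (a y)" for y
  have S: "ell2_nth (S y) = a y" for y
    using summ by (simp add: S_def Abs_ell2_inverse)
  have "cinner (T x) y = cinner x (S y)" for x y
  proof -
    have "((\<lambda>k. cinner (T (ell2_nth x k *\<^sub>C ket k)) y) has_sum cinner (T x) y) UNIV"
      by (intro has_sum_bounded_linear[OF bounded_linear_compose[OF bounded_linear_cinner_left bl]]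
          has_sum_ket)
    then show ?thesis
      by (simp add: cinner_def[of x] S a_def sc cinner_scaleC_left infsumI)
  qed
  then show ?thesis
    by (simp add: hilbert_adjoint_eqI[of T S])
qed

lemma ex_weighted_shift:
  assumes "bounded (range a)" and inj: "inj \<sigma>"
  shows "\<exists>T. bounded_clinear T \<and> (\<forall>k. T (ket k) = a k *\<^sub>R ket (\<sigma> k))"
proof -
  obtain B where B: "\<And>k. \<bar>a k\<bar> \<le> B"
    using assms(1) by (auto simp: bounded_iff)
  define f where "f x j = (if j \<in> range \<sigma> then of_real (a (inv \<sigma> j)) * x (inv \<sigma> j) else 0)"
    for x :: "'a \<Rightarrow> complex" and j
  have fs: "f x (\<sigma> k) = of_real (a k) * x k" for x k
    by (simp add: f_def inv_f_f[OF inj])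
  have le: "(cmod (f x (\<sigma> k)))\<^sup>2 \<le> B\<^sup>2 * (cmod (x k))\<^sup>2" for x k
    unfolding fs norm_mult power_mult_distrib
    by (intro mult_right_mono power2_le_iff_abs_le[THEN iffD2]) (use B[of k] in auto)
  have summ: "(\<lambda>k. (cmod (f x (\<sigma> k)))\<^sup>2) summable_on UNIV"
    if "(\<lambda>k. (cmod (x k))\<^sup>2) summable_on UNIV" for x
    by (rule summable_on_comparison_test[OF summable_on_cmult_right[OF that, of "B\<^sup>2"]])
      (use le in auto)
  have re: "(\<lambda>j. (cmod (f x j))\<^sup>2) summable_on UNIV \<longleftrightarrow> (\<lambda>k. (cmod (f x (\<sigma> k)))\<^sup>2) summable_on UNIV"
    "(\<Sum>\<^sub>\<infinity>j. (cmod (f x j))\<^sup>2) = (\<Sum>\<^sub>\<infinity>k. (cmod (f x (\<sigma> k)))\<^sup>2)" for x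
  proof -
    have "(\<lambda>j. (cmod (f x j))\<^sup>2) summable_on UNIV \<longleftrightarrow> (\<lambda>j. (cmod (f x j))\<^sup>2) summable_on range \<sigma>"
      by (rule summable_on_cong_neutral) (auto simp: f_def)
    then show "(\<lambda>j. (cmod (f x j))\<^sup>2) summable_on UNIV \<longleftrightarrow> (\<lambda>k. (cmod (f x (\<sigma> k)))\<^sup>2) summable_on UNIV"
      by (simp add: summable_on_reindex[OF inj] o_def)
    have "(\<Sum>\<^sub>\<infinity>j. (cmod (f x j))\<^sup>2) = (\<Sum>\<^sub>\<infinity>j\<in>range \<sigma>. (cmod (f x j))\<^sup>2)"
      by (rule infsum_cong_neutral) (auto simp: f_def)
    then show "(\<Sum>\<^sub>\<infinity>j. (cmod (f x j))\<^sup>2) = (\<Sum>\<^sub>\<infinity>k. (cmod (f x (\<sigma> k)))\<^sup>2)"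
      by (simp add: infsum_reindex[OF inj] o_def)
  qed
  define T where "T x = Abs_ell2 (f (ell2_nth x))" for x
  have T: "ell2_nth (T x) = f (ell2_nth x)" for x
    unfolding T_def by (rule Abs_ell2_inverse) (simp add: re summ ell2_sq_summable)
  have bound: "norm (T x) \<le> norm x * \<bar>B\<bar>" for x
  proof -
    have "(\<Sum>\<^sub>\<infinity>k. (cmod (ell2_nth (T x) k))\<^sup>2) \<le> (\<Sum>\<^sub>\<infinity>k. B\<^sup>2 * (cmod (ell2_nth x k))\<^sup>2)"
      unfolding T re
      by (intro infsum_mono summ ell2_sq_summable summable_on_cmult_right le)
    also have "\<dots> = B\<^sup>2 * (\<Sum>\<^sub>\<infinity>k. (cmod (ell2_nth x k))\<^sup>2)"
      by (rule infsum_cmult_right')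
    finally have "norm (T x) \<le> sqrt (B\<^sup>2 * (\<Sum>\<^sub>\<infinity>k. (cmod (ell2_nth x k))\<^sup>2))"
      unfolding norm_ell2_def by (rule real_sqrt_le_mono)
    then show ?thesis
      by (simp add: norm_ell2_def real_sqrt_mult mult.commute)
  qed
  have sc: "T (c *\<^sub>C x) = c *\<^sub>C T x" for c x
    by (rule ell2_eqI) (simp add: T scaleC.rep_eq f_def)
  have "bounded_linear T"
  proof (rule bounded_linear_intro[OF _ _ bound])
    show "T (x + y) = T x + T y" for x y
      by (rule ell2_eqI) (simp add: T plus_ell2.rep_eq f_def algebra_simps)
  qed (simp add: scaleR_scaleC sc)
  moreover have "T (ket k) = a k *\<^sub>R ket (\<sigma> k)" for k
    by (rule ell2_eqI) (auto simp: T f_def ket.rep_eq scaleR_ell2.rep_eq inv_f_f[OF inj])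
  ultimately show ?thesis
    using sc by (auto simp: bounded_clinear_def)
qed

section \<open>2-variable weighted shifts and spherical quasinormality\<close>

text \<open>The multi-indices are pairs of natural numbers, added componentwise; the boundedness
  and the values on the canonical basis determine the operators uniquely.\<close>

definition two_variable_weighted_shift ::
  "(nat \<times> nat \<Rightarrow> real) \<Rightarrow> (nat \<times> nat \<Rightarrow> real) \<Rightarrow>
   ((nat \<times> nat) ell2 \<Rightarrow> (nat \<times> nat) ell2) \<Rightarrow> ((nat \<times> nat) ell2 \<Rightarrow> (nat \<times> nat) ell2) \<Rightarrow> bool" where
  "two_variable_weighted_shift \<alpha> \<beta> T\<^sub>1 T\<^sub>2 \<longleftrightarrow>
     (\<forall>k. \<alpha> k > 0) \<and> (\<forall>k. \<beta> k > 0) \<and> bounded (range \<alpha>) \<and> bounded (range \<beta>) \<and>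
     bounded_clinear T\<^sub>1 \<and> bounded_clinear T\<^sub>2 \<and>
     (\<forall>k. T\<^sub>1 (ket k) = \<alpha> k *\<^sub>R ket (k + (1, 0))) \<and>
     (\<forall>k. T\<^sub>2 (ket k) = \<beta> k *\<^sub>R ket (k + (0, 1)))"

lemma ex_two_variable_weighted_shift:
  assumes "\<And>k. \<alpha> k > 0" "\<And>k. \<beta> k > 0" "bounded (range \<alpha>)" "bounded (range \<beta>)"
  shows "\<exists>T\<^sub>1 T\<^sub>2. two_variable_weighted_shift \<alpha> \<beta> T\<^sub>1 T\<^sub>2"
proof -
  have i: "inj (\<lambda>k :: nat \<times> nat. k + (1, 0))" "inj (\<lambda>k :: nat \<times> nat. k + (0, 1))"
    by (rule injI, erule add_right_imp_eq)+
  obtain T\<^sub>1 where "bounded_clinear T\<^sub>1" "\<forall>k. T\<^sub>1 (ket k) = \<alpha> k *\<^sub>R ket (k + (1, 0))"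
    using ex_weighted_shift[OF assms(3) i(1)] by auto
  moreover obtain T\<^sub>2 where "bounded_clinear T\<^sub>2" "\<forall>k. T\<^sub>2 (ket k) = \<beta> k *\<^sub>R ket (k + (0, 1))"
    using ex_weighted_shift[OF assms(4) i(2)] by auto
  ultimately have "two_variable_weighted_shift \<alpha> \<beta> T\<^sub>1 T\<^sub>2"
    using assms by (simp only: two_variable_weighted_shift_def simp_thms)
  then show ?thesis by iprover
qed

definition commuting_weights :: "(nat \<times> nat \<Rightarrow> real) \<Rightarrow> (nat \<times> nat \<Rightarrow> real) \<Rightarrow> bool" where
  "commuting_weights \<alpha> \<beta> \<longleftrightarrow> (\<forall>k. \<beta> (k + (1, 0)) * \<alpha> k = \<alpha> (k + (0, 1)) * \<beta> k)"

text \<open>This is the operator $P^2 = T_1^* T_1 + T_2^* T_2$.\<close>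

definition spherical_square ::
  "('i ell2 \<Rightarrow> 'i ell2) \<Rightarrow> ('i ell2 \<Rightarrow> 'i ell2) \<Rightarrow> 'i ell2 \<Rightarrow> 'i ell2" where
  "spherical_square T\<^sub>1 T\<^sub>2 = (\<lambda>x. hilbert_adjoint T\<^sub>1 (T\<^sub>1 x) + hilbert_adjoint T\<^sub>2 (T\<^sub>2 x))"

definition spherically_quasinormal ::
  "('i ell2 \<Rightarrow> 'i ell2) \<Rightarrow> ('i ell2 \<Rightarrow> 'i ell2) \<Rightarrow> bool" where
  "spherically_quasinormal T\<^sub>1 T\<^sub>2 \<longleftrightarrow>
     T\<^sub>1 \<circ> T\<^sub>2 = T\<^sub>2 \<circ> T\<^sub>1 \<and>
     T\<^sub>1 \<circ> spherical_square T\<^sub>1 T\<^sub>2 = spherical_square T\<^sub>1 T\<^sub>2 \<circ> T\<^sub>1 \<and>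
     T\<^sub>2 \<circ> spherical_square T\<^sub>1 T\<^sub>2 = spherical_square T\<^sub>1 T\<^sub>2 \<circ> T\<^sub>2"

end

theory Submission
  imports Defs
begin

text \<open>The operator \<open>P\<^sup>2\<close> is diagonal with entries \<open>\<gamma>\<^sub>k = \<alpha>\<^sub>k\<^sup>2 + \<beta>\<^sub>k\<^sup>2\<close>. Since the weights do not
  vanish, commutation with \<open>T\<^sub>1\<close> and \<open>T\<^sub>2\<close> says exactly that \<open>\<gamma>\<close> is invariant under both unit
  translations of the index lattice, hence constant.\<close>

text \<open>Each vector is the norm-convergent sum of its coordinates times the basis vectors
  (\<open>has_sum_ket\<close>). A bounded linear map passes through this sum, so its values on the
  basis fix it.\<close>

lemma bounded_clinear_eq_on_ket:
  assumes S: "bounded_clinear S" and T: "bounded_clinear T"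
    and eq: "\<And>k. S (ket k) = T (ket k)"
  shows "S = T"
proof
  fix x
  have image: "((\<lambda>k. ell2_nth x k *\<^sub>C A (ket k)) has_sum A x) UNIV"
    if "bounded_clinear A" for A :: "'a ell2 \<Rightarrow> 'b ell2"
    using has_sum_bounded_linear[OF _ has_sum_ket[of x], of A] that
    by (simp add: bounded_clinear_def)
  show "S x = T x"
    using has_sum_unique[OF image[OF S]] image[OF T] by (simp add: eq)
qed

lemma bounded_clinear_compose:
  assumes "bounded_clinear S" "bounded_clinear T"
  shows "bounded_clinear (S \<circ> T)"
  using assms bounded_linear_compose[of S T] by (simp add: bounded_clinear_def o_def)

lemma bounded_clinear_scaleR:
  assumes "bounded_clinear T"
  shows "T (r *\<^sub>R x) = r *\<^sub>R T x"
  using assms by (simp add: bounded_clinear_def scaleR_scaleC)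

text \<open>A coordinate is a pairing with \<open>ket k\<close>; moving \<open>T\<close> to the
  other side leaves only \<open>T (ket k)\<close>. The weight is real, so conjugation does not
  change it.\<close>

lemma ell2_nth_hilbert_adjoint_shift:
  assumes T: "bounded_clinear T" and "T (ket k) = a *\<^sub>R ket j"
  shows "ell2_nth (hilbert_adjoint T y) k = of_real a * ell2_nth y j"
proof -
  have "ell2_nth (hilbert_adjoint T y) k = cnj (cinner (T (ket k)) y)"
    by (metis T cinner_commute cinner_hilbert_adjoint cinner_ket_right)
  also have "\<dots> = of_real a * cnj (cinner (ket j) y)"
    by (simp add: assms(2) scaleR_scaleC cinner_scaleC_left)
  also have "cnj (cinner (ket j) y) = ell2_nth y j"
    by (metis cinner_commute cinner_ket_right)
  finally show ?thesis .
qed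

text \<open>Extends the action on the basis to arbitrary \<open>x\<close> without an infinite sum:
  the coordinate is a pairing with \<open>ket (\<sigma> k)\<close>, and the adjoint carries that
  vector back to a multiple of \<open>ket k\<close>.\<close>

lemma ell2_nth_shift:
  assumes T: "bounded_clinear T" and shift: "\<And>k. T (ket k) = a k *\<^sub>R ket (\<sigma> k)" and "inj \<sigma>"
  shows "ell2_nth (T x) (\<sigma> k) = of_real (a k) * ell2_nth x k"
proof -
  \<comment> \<open>Injectivity of \<open>\<sigma>\<close> leaves \<open>k\<close> as the only index
    with a nonzero coordinate.\<close>
  have adj: "hilbert_adjoint T (ket (\<sigma> k)) = of_real (a k) *\<^sub>C ket k"
    using \<open>inj \<sigma>\<close>
    by (intro ell2_eqI)
      (auto simp: ell2_nth_hilbert_adjoint_shift[OF T shift] scaleC.rep_eq ket.rep_eq inj_eq)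
  have "ell2_nth (T x) (\<sigma> k) = cinner x (of_real (a k) *\<^sub>C ket k)"
    by (metis T adj cinner_hilbert_adjoint cinner_ket_right)
  also have "\<dots> = cnj (of_real (a k) * cinner (ket k) x)"
    by (metis cinner_commute cinner_scaleC_left)
  also have "\<dots> = of_real (a k) * ell2_nth x k"
    by (metis cinner_commute cinner_ket_right complex_cnj_complex_of_real complex_cnj_mult)
  finally show ?thesis .
qed

lemma ell2_nth_adjoint_mult_shift:
  assumes "bounded_clinear T" "\<And>k. T (ket k) = a k *\<^sub>R ket (\<sigma> k)" "inj \<sigma>"
  shows "ell2_nth (hilbert_adjoint T (T x)) k = of_real ((a k)\<^sup>2) * ell2_nth x k"
  by (simp add: ell2_nth_hilbert_adjoint_shift[OF assms(1,2)] ell2_nth_shift[OF assms]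
      power2_eq_square)

lemma ell2_nth_spherical_square:
  assumes "two_variable_weighted_shift \<alpha> \<beta> T\<^sub>1 T\<^sub>2"
  shows "ell2_nth (spherical_square T\<^sub>1 T\<^sub>2 x) k
    = of_real ((\<alpha> k)\<^sup>2 + (\<beta> k)\<^sup>2) * ell2_nth x k"
proof -
  have inj: "inj (\<lambda>k :: nat \<times> nat. k + c)" for c
    by (rule injI) (erule add_right_imp_eq)
  have T: "bounded_clinear T\<^sub>1" "bounded_clinear T\<^sub>2"
    "T\<^sub>1 (ket k) = \<alpha> k *\<^sub>R ket (k + (1, 0))" "T\<^sub>2 (ket k) = \<beta> k *\<^sub>R ket (k + (0, 1))" for k
    using assms by (simp_all only: two_variable_weighted_shift_def)
  show ?thesis
    by (simp add: spherical_square_def plus_ell2.rep_eq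
        ell2_nth_adjoint_mult_shift[OF T(1,3) inj] ell2_nth_adjoint_mult_shift[OF T(2,4) inj]
        distrib_right del: of_real_power)
qed

text \<open>A diagonal operator is scalar exactly when its entries agree, as testing on basis
  vectors shows. With \<open>C\<close> fixed, (ii) and (iii) share the same constant.\<close>

lemma spherical_square_eq_scaleR_iff:
  assumes "two_variable_weighted_shift \<alpha> \<beta> T\<^sub>1 T\<^sub>2"
  shows "spherical_square T\<^sub>1 T\<^sub>2 = (\<lambda>x. C *\<^sub>R x) \<longleftrightarrow> (\<forall>k. (\<alpha> k)\<^sup>2 + (\<beta> k)\<^sup>2 = C)"
proof
  assume eq: "spherical_square T\<^sub>1 T\<^sub>2 = (\<lambda>x. C *\<^sub>R x)"
  show "\<forall>k. (\<alpha> k)\<^sup>2 + (\<beta> k)\<^sup>2 = C"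
  proof
    fix k
    have "complex_of_real ((\<alpha> k)\<^sup>2 + (\<beta> k)\<^sup>2) = of_real C"
      using ell2_nth_spherical_square[OF assms, of "ket k" k]
      by (simp add: eq scaleR_ell2.rep_eq ket.rep_eq)
    then show "(\<alpha> k)\<^sup>2 + (\<beta> k)\<^sup>2 = C"
      by (simp only: of_real_eq_iff)
  qed
next
  assume "\<forall>k. (\<alpha> k)\<^sup>2 + (\<beta> k)\<^sup>2 = C"
  \<comment> \<open>The sum inside \<open>of_real\<close> and the quantifier over pairs are kept
    intact, so that the assumption rewrites the diagonal entry to \<open>C\<close>.\<close>
  then show "spherical_square T\<^sub>1 T\<^sub>2 = (\<lambda>x. C *\<^sub>R x)"
    by (intro ext ell2_eqI)
      (simp add: ell2_nth_spherical_square[OF assms] scaleR_ell2.rep_eq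
        del: of_real_add split_paired_All)
qed

text \<open>Both products send \<open>ket k\<close> to a multiple of the basis vector at
  \<open>k + (1, 1)\<close>; the weight relation says that the two multiples agree.\<close>

lemma two_variable_weighted_shift_commute:
  assumes W: "two_variable_weighted_shift \<alpha> \<beta> T\<^sub>1 T\<^sub>2" and comm: "commuting_weights \<alpha> \<beta>"
  shows "T\<^sub>1 \<circ> T\<^sub>2 = T\<^sub>2 \<circ> T\<^sub>1"
proof (rule bounded_clinear_eq_on_ket)
  have T: "bounded_clinear T\<^sub>1" "bounded_clinear T\<^sub>2"
    "T\<^sub>1 (ket k) = \<alpha> k *\<^sub>R ket (k + (1, 0))" "T\<^sub>2 (ket k) = \<beta> k *\<^sub>R ket (k + (0, 1))" for k
    using W by (simp_all only: two_variable_weighted_shift_def)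
  show "bounded_clinear (T\<^sub>1 \<circ> T\<^sub>2)" "bounded_clinear (T\<^sub>2 \<circ> T\<^sub>1)"
    by (intro bounded_clinear_compose T)+
  fix k :: "nat \<times> nat"
  have "\<beta> k * \<alpha> (k + (0, 1)) = \<alpha> k * \<beta> (k + (1, 0))"
    using comm by (simp only: commuting_weights_def mult.commute)
  moreover have "k + (0, 1) + (1, 0) = k + (1, 0) + (0, 1)"
    by (simp only: ac_simps)
  ultimately show "(T\<^sub>1 \<circ> T\<^sub>2) (ket k) = (T\<^sub>2 \<circ> T\<^sub>1) (ket k)"
    by (simp only: o_def T(3,4) bounded_clinear_scaleR[OF T(1)] bounded_clinear_scaleR[OF T(2)]
        scaleR_scaleR)
qed

text \<open>Applied to \<open>ket k\<close>, the two orders give \<open>d k * a\<close> and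
  \<open>d j * a\<close> as coefficients of \<open>ket j\<close>, and \<open>a\<close>
  cancels.\<close>

lemma shift_commute_diagonal:
  assumes T: "bounded_clinear T" and shift: "T (ket k) = a *\<^sub>R ket j" and "a \<noteq> 0"
    and diag: "\<And>x i. ell2_nth (D x) i = of_real (d i) * ell2_nth x i"
    and comm: "T \<circ> D = D \<circ> T"
  shows "d j = d k"
proof -
  have D: "D (ket k) = d k *\<^sub>R ket k"
    by (rule ell2_eqI) (auto simp: diag scaleR_ell2.rep_eq ket.rep_eq)
  have "T (D (ket k)) = D (T (ket k))"
    using fun_cong[OF comm, of "ket k"] by simp
  then have "(d k * a) *\<^sub>R ket j = D (a *\<^sub>R ket j)"
    by (simp add: D shift bounded_clinear_scaleR[OF T])
  then have "ell2_nth ((d k * a) *\<^sub>R ket j) j = ell2_nth (D (a *\<^sub>R ket j)) j"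
    by simp
  then show ?thesis
    using \<open>a \<noteq> 0\<close> by (simp add: diag scaleR_ell2.rep_eq ket.rep_eq)
qed

lemma translation_invariant_const:
  fixes f :: "nat \<times> nat \<Rightarrow> 'a"
  assumes "\<And>k. f (k + (1, 0)) = f k" "\<And>k. f (k + (0, 1)) = f k"
  shows "f k = f (0, 0)"
proof -
  have "f (m, n) = f (0, n)" for m n
    using assms(1)[of "(_, n)"] by (induction m) auto
  moreover have "f (0, n) = f (0, 0)" for n
    using assms(2)[of "(0, _)"] by (induction n) auto
  ultimately show ?thesis
    by (metis surj_pair)
qed

theorem theorem2p10:
  fixes \<alpha> \<beta> :: "nat \<times> nat \<Rightarrow> real"
    and T\<^sub>1 T\<^sub>2 :: "(nat \<times> nat) ell2 \<Rightarrow> (nat \<times> nat) ell2"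
  assumes "two_variable_weighted_shift \<alpha> \<beta> T\<^sub>1 T\<^sub>2"
    and "commuting_weights \<alpha> \<beta>"
  shows "(spherically_quasinormal T\<^sub>1 T\<^sub>2 \<longleftrightarrow>
            (\<exists>C>0. \<forall>k\<^sub>1 k\<^sub>2. (\<alpha> (k\<^sub>1, k\<^sub>2))\<^sup>2 + (\<beta> (k\<^sub>1, k\<^sub>2))\<^sup>2 = C)) \<and>
         ((\<exists>C>0. \<forall>k\<^sub>1 k\<^sub>2. (\<alpha> (k\<^sub>1, k\<^sub>2))\<^sup>2 + (\<beta> (k\<^sub>1, k\<^sub>2))\<^sup>2 = C) \<longleftrightarrow>
            (\<exists>C::real>0. spherical_square T\<^sub>1 T\<^sub>2 = (\<lambda>x. C *\<^sub>R x)))"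
proof -
  note W = assms(1)
  let ?P = "spherical_square T\<^sub>1 T\<^sub>2"
  let ?\<gamma> = "\<lambda>k. (\<alpha> k)\<^sup>2 + (\<beta> k)\<^sup>2"
  have pos: "\<alpha> k > 0" "\<beta> k > 0" for k
    using W by (simp_all only: two_variable_weighted_shift_def)
  have T: "bounded_clinear T\<^sub>1" "bounded_clinear T\<^sub>2"
    "T\<^sub>1 (ket k) = \<alpha> k *\<^sub>R ket (k + (1, 0))" "T\<^sub>2 (ket k) = \<beta> k *\<^sub>R ket (k + (0, 1))" for k
    using W by (simp_all only: two_variable_weighted_shift_def)
  have "\<exists>C>0. \<forall>k. ?\<gamma> k = C" if "spherically_quasinormal T\<^sub>1 T\<^sub>2"
  proof -
    have comm: "T\<^sub>1 \<circ> ?P = ?P \<circ> T\<^sub>1" "T\<^sub>2 \<circ> ?P = ?P \<circ> T\<^sub>2"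
      using that by (simp_all add: spherically_quasinormal_def)
    have nz: "\<alpha> k \<noteq> 0" "\<beta> k \<noteq> 0" for k
      using pos[of k] by simp_all
    note diag = ell2_nth_spherical_square[OF W]
    have "?\<gamma> k = ?\<gamma> (0, 0)" for k
      by (rule translation_invariant_const[of ?\<gamma>])
        (rule shift_commute_diagonal[OF T(1,3) nz(1) diag comm(1)]
          shift_commute_diagonal[OF T(2,4) nz(2) diag comm(2)])+
    \<comment> \<open>The entry at the origin serves as the constant \<open>C\<close>.\<close>
    moreover have "?\<gamma> (0, 0) > 0"
      by (intro add_pos_pos zero_less_power pos)
    ultimately show ?thesis
      by blast
  qed
  \<comment> \<open>A scalar operator commutes with every linear map; that the shifts commute with
    each other comes from the weights.\<close>
  moreover have "spherically_quasinormal T\<^sub>1 T\<^sub>2" if "?P = (\<lambda>x. C *\<^sub>R x)" for C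
    unfolding spherically_quasinormal_def that
    using two_variable_weighted_shift_commute[OF assms]
    by (simp add: fun_eq_iff bounded_clinear_scaleR T(1,2))
  \<comment> \<open>Rewriting turns (iii) into (ii), so the two implications proved above close the
    equivalence with (i).\<close>
  ultimately show ?thesis
    unfolding spherical_square_eq_scaleR_iff[OF W] split_paired_All by blast
qed

end
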